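(* Let $t\geq 2$ and let $\Gamma$ be a $t$-walk-regular graph with valency $k$ which has a $t$-walk-regular idempotent of rank at most $t$ for an eigenvalue $\theta\neq\pm k$. Then $\Gamma$ is distance-regular.
   Context: All graphs are finite, simple and connected, with adjacency matrix $A$; $A_j$ denotes the distance-$j$ matrix ($(A_j)_{xy}=1$ iff $\mathrm{dist}(x,y)=j$). A graph is $t$-walk-regular if it has diameter at least $t$ and for every $\ell\geq 0$ the number of walks of length $\ell$ between $x$ and $y$ depends only on $\mathrm{dist}(x,y)$ whenever $\mathrm{dist}(x,y)\leq t$; such a graph is regular. A $t$-walk-regular idempotent for an eigenvalue $\theta$ is a nonzero real symmetric matrix $E$ with $E^2=E$, $AE=\theta E$, and constants $\alpha_0,\dots,\alpha_t$ with $A_j\circ E=\alpha_j A_j$ for $0\leq j\leq t$ ($\circ$ the entrywise product). A graph of diameter $D$ is distance-regular if for all $0\leq j\leq D$ and all vertices $x,y$ with $\mathrm{dist}(x,y)=j$, the numbers of neighbors of $y$ at distance $j-1$, $j$, $j+1$ from $x$ depend only on $j$. *)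

theory Defs
  imports "HOL-Analysis.Analysis"
begin

text \<open>A graph is given by its adjacency relation on a finite vertex type.\<close>

definition simple_graph :: "('v \<Rightarrow> 'v \<Rightarrow> bool) \<Rightarrow> bool" where
  "simple_graph adj \<longleftrightarrow> symp adj \<and> irreflp adj"

definition connected_graph :: "('v \<Rightarrow> 'v \<Rightarrow> bool) \<Rightarrow> bool" where
  "connected_graph adj \<longleftrightarrow> (\<forall>x y. adj\<^sup>*\<^sup>* x y)"

definition has_valency :: "('v \<Rightarrow> 'v \<Rightarrow> bool) \<Rightarrow> nat \<Rightarrow> bool" where
  "has_valency adj k \<longleftrightarrow> (\<forall>x. card {y. adj x y} = k)"

text \<open>A walk of length \<open>l\<close> is the list of its \<open>l + 1\<close> vertices.\<close>

definition walks :: "('v \<Rightarrow> 'v \<Rightarrow> bool) \<Rightarrow> nat \<Rightarrow> 'v \<Rightarrow> 'v \<Rightarrow> 'v list set" where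
  "walks adj l x y = {p. length p = Suc l \<and> hd p = x \<and> last p = y \<and> successively adj p}"

text \<open>Only meaningful for vertices joined by some walk, in particular in connected graphs.\<close>

definition gdist :: "('v \<Rightarrow> 'v \<Rightarrow> bool) \<Rightarrow> 'v \<Rightarrow> 'v \<Rightarrow> nat" where
  "gdist adj x y = (LEAST l. walks adj l x y \<noteq> {})"

definition diam :: "('v::finite \<Rightarrow> 'v \<Rightarrow> bool) \<Rightarrow> nat" where
  "diam adj = Max {gdist adj x y | x y. True}"

definition adj_mat :: "('v::finite \<Rightarrow> 'v \<Rightarrow> bool) \<Rightarrow> real^'v^'v" where
  "adj_mat adj = (\<chi> x y. if adj x y then 1 else 0)"

definition dist_mat :: "('v::finite \<Rightarrow> 'v \<Rightarrow> bool) \<Rightarrow> nat \<Rightarrow> real^'v^'v" where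
  "dist_mat adj j = (\<chi> x y. if gdist adj x y = j then 1 else 0)"

definition entrywise_prod :: "real^'n^'m \<Rightarrow> real^'n^'m \<Rightarrow> real^'n^'m" where
  "entrywise_prod M N = (\<chi> x y. M $ x $ y * N $ x $ y)"

definition walk_regular :: "nat \<Rightarrow> ('v::finite \<Rightarrow> 'v \<Rightarrow> bool) \<Rightarrow> bool" where
  "walk_regular t adj \<longleftrightarrow>
     t \<le> diam adj \<and>
     (\<forall>l. \<exists>w :: nat \<Rightarrow> nat. \<forall>x y. gdist adj x y \<le> t \<longrightarrow>
        card (walks adj l x y) = w (gdist adj x y))"

definition walk_regular_idempotent ::
    "nat \<Rightarrow> ('v::finite \<Rightarrow> 'v \<Rightarrow> bool) \<Rightarrow> real \<Rightarrow> real^'v^'v \<Rightarrow> bool" where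
  "walk_regular_idempotent t adj \<theta> E \<longleftrightarrow>
     E \<noteq> 0 \<and> transpose E = E \<and> E ** E = E \<and> adj_mat adj ** E = \<theta> *\<^sub>R E \<and>
     (\<exists>\<alpha> :: nat \<Rightarrow> real. \<forall>j\<le>t.
        entrywise_prod (dist_mat adj j) E = \<alpha> j *\<^sub>R dist_mat adj j)"

text \<open>
  The condition \<open>gdist adj x z + 1 = j\<close> says that \<open>z\<close> is at distance \<open>j - 1\<close> from \<open>x\<close>;
  it avoids truncated subtraction, so that no vertex satisfies it when \<open>j = 0\<close>.
\<close>

definition distance_regular :: "('v::finite \<Rightarrow> 'v \<Rightarrow> bool) \<Rightarrow> bool" where
  "distance_regular adj \<longleftrightarrow>
     (\<exists>c a b :: nat \<Rightarrow> nat. \<forall>j\<le>diam adj. \<forall>x y. gdist adj x y = j \<longrightarrow>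
        card {z. adj y z \<and> gdist adj x z + 1 = j} = c j \<and>
        card {z. adj y z \<and> gdist adj x z = j} = a j \<and>
        card {z. adj y z \<and> gdist adj x z = j + 1} = b j)"

end

theory Submission
  imports Defs
begin

text \<open>
  In a \<open>t\<close>-walk-regular graph the numbers \<open>c j\<close>, \<open>a j\<close>, \<open>b j\<close> are well defined for \<open>j \<le> t\<close>, which
  settles the case of diameter \<open>t\<close>. If the diameter exceeds \<open>t\<close>, the rows of \<open>E\<close> at the \<open>t + 1\<close>
  vertices of a geodesic of length \<open>t\<close> are linearly dependent, since \<open>E\<close> has rank at most \<open>t\<close>.
  As their inner products are entries of \<open>E\<close>, and as vertices at distance \<open>1\<close> or \<open>2\<close> have
  different rows, this forces \<open>b j = 1\<close> for some \<open>j < t\<close>, hence \<open>b t = 1\<close>. But a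
  \<open>t\<close>-walk-regular graph with \<open>b t = 1\<close> is \<open>(t + 1)\<close>-walk-regular, again with at most one
  neighbour further out, so walk-regularity propagates up to the diameter.
\<close>

section \<open>Walks, distance and diameter\<close>

lemma finite_walks: "finite (walks adj l x (y::'v::finite))"
proof -
  have "walks adj l x y \<subseteq> {p. set p \<subseteq> UNIV \<and> length p = Suc l}"
    by (auto simp: walks_def)
  then show ?thesis
    by (rule finite_subset) (rule finite_lists_length_eq[OF finite])
qed

lemma walks_0: "walks adj 0 x y = (if x = y then {[x]} else {})"
  by (auto simp: walks_def length_Suc_conv)

lemma walks_Suc: "walks adj (Suc l) x y = (\<Union>z\<in>{z. adj z y}. (\<lambda>q. q @ [y]) ` walks adj l x z)"
proof (intro equalityI subsetI)
  fix p assume p: "p \<in> walks adj (Suc l) x y"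
  define q where "q = butlast p"
  have ne: "p \<noteq> []" "q \<noteq> []"
    using p by (auto simp: walks_def q_def simp flip: length_0_conv)
  have pq: "p = q @ [y]"
    using p append_butlast_last_id[OF ne(1)] unfolding walks_def q_def by (metis (mono_tags) mem_Collect_eq)
  have "q \<in> walks adj l x (last q)" "adj (last q) y"
    using p ne(2) unfolding pq walks_def by (auto simp: successively_append_iff)
  then show "p \<in> (\<Union>z\<in>{z. adj z y}. (\<lambda>q. q @ [y]) ` walks adj l x z)"
    using pq by blast
next
  fix p assume "p \<in> (\<Union>z\<in>{z. adj z y}. (\<lambda>q. q @ [y]) ` walks adj l x z)"
  then obtain z q where z: "adj z y" "q \<in> walks adj l x z" "p = q @ [y]"
    by blast
  then have "q \<noteq> []"
    by (auto simp: walks_def)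
  then show "p \<in> walks adj (Suc l) x y"
    using z by (auto simp: walks_def successively_append_iff)
qed

lemma card_walks_Suc:
  "card (walks adj (Suc l) x (y::'v::finite)) = (\<Sum>z | adj z y. card (walks adj l x z))"
proof -
  have "card (\<Union>z\<in>{z. adj z y}. (\<lambda>q. q @ [y]) ` walks adj l x z)
      = (\<Sum>z | adj z y. card ((\<lambda>q. q @ [y]) ` walks adj l x z))"
  proof (rule card_UN_disjoint)
    show "\<forall>z\<in>{z. adj z y}. finite ((\<lambda>q. q @ [y]) ` walks adj l x z)"
      by (simp add: finite_walks)
  qed (auto simp: walks_def)
  also have "\<dots> = (\<Sum>z | adj z y. card (walks adj l x z))"
    by (intro sum.cong refl card_image) (simp add: inj_on_def)
  finally show ?thesis
    by (simp add: walks_Suc)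
qed

text \<open>Replaces lists of vertices by powers of the relation, through which distances are
  handled from here on.\<close>

lemma walks_nonempty_iff: "walks adj l x y \<noteq> {} \<longleftrightarrow> (adj ^^ l) x y"
proof (induction l arbitrary: y)
  case 0
  then show ?case by (auto simp: walks_0)
next
  case (Suc l)
  have "walks adj (Suc l) x y \<noteq> {} \<longleftrightarrow> (\<exists>z. adj z y \<and> walks adj l x z \<noteq> {})"
    by (auto simp: walks_Suc)
  then show ?case
    by (auto simp: Suc relcompp_apply)
qed

lemma gdist_eq: "gdist adj x y = (LEAST l. (adj ^^ l) x y)"
  by (simp add: gdist_def walks_nonempty_iff)

lemma gdist_le: "(adj ^^ l) x y \<Longrightarrow> gdist adj x y \<le> l"
  unfolding gdist_eq by (rule Least_le)

lemma gdist_self [simp]: "gdist adj x x = 0"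
  using gdist_le[of 0 adj x x] by simp

lemma gdist_le_diam: "gdist adj x y \<le> diam adj"
proof -
  have "{gdist adj x y | x y. True} = (\<lambda>(x, y). gdist adj x y) ` UNIV"
    by auto
  then show ?thesis
    unfolding diam_def by (intro Max_ge) auto
qed

lemma diam_attained:
  obtains x y where "gdist adj x y = diam adj"
proof -
  have "{gdist adj x y | x y. True} = (\<lambda>(x, y). gdist adj x y) ` UNIV"
    by auto
  then have "diam adj \<in> (\<lambda>(x, y). gdist adj x y) ` UNIV"
    unfolding diam_def by (metis Max_in finite finite_imageI image_is_empty UNIV_not_empty)
  then show ?thesis
    using that by auto
qed

text \<open>With \<open>j = gdist adj x y\<close>, the sizes of this set and of the next two are the
  candidates for \<open>c j\<close>, \<open>a j\<close> and \<open>b j\<close>.\<close>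

definition nbrs_below :: "('v \<Rightarrow> 'v \<Rightarrow> bool) \<Rightarrow> 'v \<Rightarrow> 'v \<Rightarrow> 'v set" where
  "nbrs_below adj x y = {z. adj y z \<and> gdist adj x z + 1 = gdist adj x y}"

definition nbrs_level :: "('v \<Rightarrow> 'v \<Rightarrow> bool) \<Rightarrow> 'v \<Rightarrow> 'v \<Rightarrow> 'v set" where
  "nbrs_level adj x y = {z. adj y z \<and> gdist adj x z = gdist adj x y}"

definition nbrs_above :: "('v \<Rightarrow> 'v \<Rightarrow> bool) \<Rightarrow> 'v \<Rightarrow> 'v \<Rightarrow> 'v set" where
  "nbrs_above adj x y = {z. adj y z \<and> gdist adj x z = gdist adj x y + 1}"

section \<open>Distances and geodesics in a connected graph\<close>

locale connected_simple_graph =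
  fixes adj :: "'v::finite \<Rightarrow> 'v \<Rightarrow> bool"
  assumes simple: "simple_graph adj"
    and connected: "connected_graph adj"
begin

abbreviation d :: "'v \<Rightarrow> 'v \<Rightarrow> nat" where "d \<equiv> gdist adj"

lemma adj_sym: "adj x y \<Longrightarrow> adj y x"
  using simple by (auto simp: simple_graph_def dest: sympD)

lemma adj_irrefl: "\<not> adj x x"
  using simple by (auto simp: simple_graph_def irreflp_def)

lemma relpowp_d: "(adj ^^ d x y) x y"
proof -
  have "\<exists>l. (adj ^^ l) x y"
    using connected unfolding connected_graph_def by (meson rtranclp_imp_relpowp)
  then show ?thesis
    unfolding gdist_eq by (rule LeastI_ex)
qed

lemma relpowp_sym: "(adj ^^ l) x y \<Longrightarrow> (adj ^^ l) y x"
proof (induction l arbitrary: y)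
  case (Suc l)
  then obtain z where "(adj ^^ l) x z" "adj z y" by auto
  then show ?case
    using Suc.IH adj_sym relpowp_Suc_I2 by metis
qed auto

lemma d_sym: "d x y = d y x"
  using gdist_le relpowp_d relpowp_sym by (metis le_antisym)

lemma d_eq_0_iff [simp]: "d x y = 0 \<longleftrightarrow> x = y"
  using relpowp_d[of x y] by auto

lemma d_triangle: "d x z \<le> d x y + d y z"
  by (intro gdist_le) (metis relcomppI relpowp_d relpowp_add)

lemma d_adj: "adj x y \<Longrightarrow> d x y = 1"
  using gdist_le[of 1 adj x y] d_eq_0_iff[of x y] adj_irrefl[of x]
  by (cases "d x y") auto

lemma d_eq_1_iff: "d x y = 1 \<longleftrightarrow> adj x y"
  using d_adj relpowp_d[of x y] by (metis relpowp_1)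

lemma d_nbr_cases:
  assumes "adj y z"
  obtains "d x z + 1 = d x y" | "d x z = d x y" | "d x z = d x y + 1"
  using d_triangle[of x z y] d_triangle[of x y z] d_adj[OF assms] d_adj[OF adj_sym[OF assms]]
  by linarith

lemma d_Suc_ex:
  assumes "d x z = Suc n"
  obtains y where "adj y z" "d x y = n"
proof -
  obtain y where y: "(adj ^^ n) x y" "adj y z"
    using relpowp_d[of x z] assms by auto
  have "d x y = n"
    using gdist_le[OF y(1)] d_triangle[of x z y] d_adj[OF y(2)] assms by simp
  then show ?thesis
    using that y by blast
qed

text \<open>The steps of a shortest walk bound the distance of \<open>f p\<close> and
  \<open>f q\<close> by \<open>q - p\<close>; a smaller distance would give a shortcut for the whole
  walk.\<close>

lemma geodesic_ex:
  assumes "d x y = n"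
  obtains f where "f 0 = x" "f n = y" "\<And>p q. p \<le> q \<Longrightarrow> q \<le> n \<Longrightarrow> d (f p) (f q) = q - p"
proof -
  obtain f where f: "f 0 = x" "f n = y" and adj_step: "\<And>i. i < n \<Longrightarrow> adj (f i) (f (Suc i))"
    using relpowp_d[of x y] assms by (auto simp: relpowp_fun_conv)
  have le: "p \<le> q \<Longrightarrow> q \<le> n \<Longrightarrow> d (f p) (f q) \<le> q - p" for p q
  proof (induction q rule: dec_induct)
    case (step q)
    then show ?case
      using d_triangle[of "f p" "f (Suc q)" "f q"] d_adj[OF adj_step[of q]] by simp
  qed simp
  have "d (f p) (f q) = q - p" if "p \<le> q" "q \<le> n" for p q
    using le[of 0 p] le[of p q] le[of q n] d_triangle[of "f 0" "f q" "f p"]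
      d_triangle[of "f 0" "f n" "f q"] f assms that by simp
  then show ?thesis
    using that f by blast
qed

lemma card_walks_pos: "card (walks adj (d x y) x y) > 0"
  using relpowp_d[of x y] finite_walks by (metis walks_nonempty_iff card_gt_0_iff)

lemma card_walks_0: "l < d x y \<Longrightarrow> card (walks adj l x y) = 0"
  using gdist_le by (metis walks_nonempty_iff card.empty not_le)

lemma sum_nbrs:
  fixes g :: "'v \<Rightarrow> nat"
  shows "(\<Sum>z | adj z y. g z)
     = sum g (nbrs_below adj x y) + sum g (nbrs_level adj x y) + sum g (nbrs_above adj x y)"
proof -
  have "{z. adj z y} = nbrs_below adj x y \<union> nbrs_level adj x y \<union> nbrs_above adj x y"
    using adj_sym d_nbr_cases[of y _ x]
    unfolding nbrs_below_def nbrs_level_def nbrs_above_def by blast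
  moreover have "nbrs_below adj x y \<inter> nbrs_level adj x y = {}"
    "(nbrs_below adj x y \<union> nbrs_level adj x y) \<inter> nbrs_above adj x y = {}"
    by (auto simp: nbrs_below_def nbrs_level_def nbrs_above_def)
  ultimately show ?thesis
    by (simp add: sum.union_disjoint)
qed

lemma card_nbrs:
  assumes "has_valency adj k"
  shows "card (nbrs_below adj x y) + card (nbrs_level adj x y) + card (nbrs_above adj x y) = k"
proof -
  have "{z. adj z y} = {z. adj y z}"
    using adj_sym by auto
  then show ?thesis
    using sum_nbrs[of "\<lambda>_. 1" y x] assms by (simp add: has_valency_def)
qed

section \<open>Walk-regularity and the numbers \<open>c j\<close>, \<open>a j\<close>,
  \<open>b j\<close>\<close>

lemma walk_regularE:
  assumes "walk_regular t adj"
  obtains w where "\<And>l x y. d x y \<le> t \<Longrightarrow> card (walks adj l x y) = w l (d x y)"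
proof -
  have "\<forall>l. \<exists>v. \<forall>x y. d x y \<le> t \<longrightarrow> card (walks adj l x y) = v (d x y)"
    using assms by (simp add: walk_regular_def)
  from choice[OF this] show ?thesis
    using that by blast
qed

text \<open>Walks are sorted by their last step. The sum over \<open>nbrs_above\<close> stays
  unevaluated because these vertices may be at distance \<open>t + 1\<close>, where \<open>w\<close>
  gives no information. For \<open>x = y\<close> the truncated \<open>d x y - 1\<close> is harmless,
  as \<open>nbrs_below\<close> is then empty.\<close>

lemma card_walks_Suc_nbrs:
  assumes w: "\<And>l x y. d x y \<le> t \<Longrightarrow> card (walks adj l x y) = w l (d x y)"
    and le: "d x y \<le> t"
  shows "card (walks adj (Suc l) x y)
    = card (nbrs_below adj x y) * w l (d x y - 1) + card (nbrs_level adj x y) * w l (d x y)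
      + (\<Sum>z\<in>nbrs_above adj x y. card (walks adj l x z))"
proof -
  have "(\<Sum>z\<in>nbrs_below adj x y. card (walks adj l x z))
      = (\<Sum>z\<in>nbrs_below adj x y. w l (d x y - 1))"
  proof (intro sum.cong refl)
    fix z assume "z \<in> nbrs_below adj x y"
    then have "d x y - 1 = d x z" "d x z \<le> t"
      using le by (auto simp: nbrs_below_def)
    then show "card (walks adj l x z) = w l (d x y - 1)"
      by (simp add: w)
  qed
  moreover have "(\<Sum>z\<in>nbrs_level adj x y. card (walks adj l x z))
      = (\<Sum>z\<in>nbrs_level adj x y. w l (d x y))"
    using le by (intro sum.cong) (auto simp: nbrs_level_def w)
  ultimately show ?thesis
    unfolding card_walks_Suc sum_nbrs[of _ y x] by simp
qed

text \<open>Walks of length \<open>d x y\<close> determine the first number, walks one step longer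
  the second, and the valency the third.\<close>

lemma walk_regular_card_nbrs:
  assumes wr: "walk_regular t adj" and val: "has_valency adj k"
    and eq: "d x y = d x' y'" and le: "d x y \<le> t"
  shows "card (nbrs_below adj x y) = card (nbrs_below adj x' y')"
    and "card (nbrs_level adj x y) = card (nbrs_level adj x' y')"
    and "card (nbrs_above adj x y) = card (nbrs_above adj x' y')"
proof -
  obtain w where w: "\<And>l x y. d x y \<le> t \<Longrightarrow> card (walks adj l x y) = w l (d x y)"
    using walk_regularE[OF wr] by blast
  have pos: "w (d u v) (d u v) > 0" if "d u v \<le> t" for u v
    using card_walks_pos[of u v] w[OF that] by simp
  \<comment> \<open>Walks of length at most \<open>d u v\<close> do not reach the vertices further
    out, so the sum that \<open>w\<close> does not control vanishes.\<close>
  have above: "(\<Sum>z\<in>nbrs_above adj u v. card (walks adj l u z)) = 0" if "l \<le> d u v" for l u v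
    using that by (intro sum.neutral) (auto simp: nbrs_above_def intro!: card_walks_0)
  \<comment> \<open>Walks of length \<open>i\<close> do not reach distance \<open>i + 1\<close>
    either, so only the neighbours closer to \<open>u\<close> contribute.\<close>
  have below: "w (Suc i) (Suc i) = card (nbrs_below adj u v) * w i i"
    if "d u v = Suc i" "Suc i \<le> t" for u v i
    using card_walks_Suc_nbrs[OF w, where x = u and y = v and l = i] above[of i u v] that
      w[of u v i] w[of u v "Suc i"] card_walks_0[of i u v] by simp
  show *: "card (nbrs_below adj x y) = card (nbrs_below adj x' y')"
  proof (cases "d x y")
    case 0
    then have "nbrs_below adj x y = {}" "nbrs_below adj x' y' = {}"
      using eq by (auto simp: nbrs_below_def)
    then show ?thesis by simp
  next
    case (Suc i)
    \<comment> \<open>A vertex at distance \<open>i\<close> makes \<open>w i i\<close> positive, so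
      that it can be cancelled.\<close>
    obtain z where "d x z = i"
      using d_Suc_ex[OF Suc] by blast
    then have "w i i > 0"
      using pos[of x z] Suc le by simp
    then show ?thesis
      using below[of x y i] below[of x' y' i] Suc eq le by simp
  qed
  \<comment> \<open>One step more brings in the neighbours at equal distance; their coefficient is
    positive, so their number can be solved for.\<close>
  have level: "w (Suc (d u v)) (d u v)
      = card (nbrs_below adj u v) * w (d u v) (d u v - 1) + card (nbrs_level adj u v) * w (d u v) (d u v)"
    if "d u v \<le> t" for u v
    using card_walks_Suc_nbrs[OF w that, where l = "d u v"] above[of "d u v" u v]
      w[OF that, of "Suc (d u v)"] by simp
  show **: "card (nbrs_level adj x y) = card (nbrs_level adj x' y')"
    using level[of x y] level[of x' y'] pos[of x y] le * by (simp add: eq)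
  show "card (nbrs_above adj x y) = card (nbrs_above adj x' y')"
    using card_nbrs[OF val, of x y] card_nbrs[OF val, of x' y'] * ** by simp
qed

lemma walk_regular_diam_imp_distance_regular:
  assumes "walk_regular (diam adj) adj" and "has_valency adj k"
  shows "distance_regular adj"
proof -
  have "\<exists>c a b. \<forall>x y. d x y = j \<longrightarrow> card (nbrs_below adj x y) = c \<and>
      card (nbrs_level adj x y) = a \<and> card (nbrs_above adj x y) = b" for j
  proof (cases "\<exists>x y. d x y = j")
    case True
    then obtain x y where "d x y = j" by blast
    then show ?thesis
      using walk_regular_card_nbrs[OF assms, of _ _ x y] gdist_le_diam by metis
  qed auto
  then obtain c a b where cab: "\<And>j x y. d x y = j \<Longrightarrow> card (nbrs_below adj x y) = c j \<and>
      card (nbrs_level adj x y) = a j \<and> card (nbrs_above adj x y) = b j"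
    by metis
  then have "\<forall>j\<le>diam adj. \<forall>x y. d x y = j \<longrightarrow>
      card {z. adj y z \<and> d x z + 1 = j} = c j \<and> card {z. adj y z \<and> d x z = j} = a j \<and>
      card {z. adj y z \<and> d x z = j + 1} = b j"
    by (auto simp: nbrs_below_def nbrs_level_def nbrs_above_def)
  then show ?thesis
    unfolding distance_regular_def by blast
qed

section \<open>Propagation when at most one neighbour lies further out\<close>

text \<open>The triangle inequality through \<open>x'\<close> puts \<open>z\<close> beyond
  \<open>y\<close> as seen from \<open>x'\<close> too. This gives the monotonicity of
  \<open>b\<close>: moving the base point along a geodesic towards \<open>y\<close> can only enlarge
  the set.\<close>

lemma nbrs_above_antimono:
  assumes "d x y = d x x' + d x' y"
  shows "nbrs_above adj x y \<subseteq> nbrs_above adj x' y"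
proof
  fix z assume "z \<in> nbrs_above adj x y"
  then show "z \<in> nbrs_above adj x' y"
    using assms d_triangle[of x z x'] d_triangle[of x' z y] d_adj[of y z]
    by (simp add: nbrs_above_def)
qed

text \<open>
  If \<open>z\<close> is the only neighbour of \<open>y\<close> at distance \<open>s + 1\<close> from \<open>x\<close>, then the number of walks from
  \<open>x\<close> to \<open>z\<close> is determined by the number of walks to \<open>y\<close> that are one step longer.
\<close>

lemma walk_regular_Suc:
  assumes wr: "walk_regular s adj" and val: "has_valency adj k" and less: "s < diam adj"
    and one: "\<And>x y. d x y = s \<Longrightarrow> card (nbrs_above adj x y) \<le> 1"
  shows "walk_regular (Suc s) adj"
proof -
  obtain w where w: "\<And>l x y. d x y \<le> s \<Longrightarrow> card (walks adj l x y) = w l (d x y)"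
    using walk_regularE[OF wr] by blast
  have eq: "card (walks adj l x z) = card (walks adj l x' z')"
    if zs: "d x z = Suc s" "d x' z' = Suc s" for l x z x' z'
  proof -
    obtain y where y: "adj y z" "d x y = s"
      using d_Suc_ex[OF zs(1)] by blast
    obtain y' where y': "adj y' z'" "d x' y' = s"
      using d_Suc_ex[OF zs(2)] by blast
    have single: "nbrs_above adj u v = {c}" if "d u v = s" "adj v c" "d u c = Suc s" for u v c
    proof -
      have "c \<in> nbrs_above adj u v"
        using that by (simp add: nbrs_above_def)
      then show ?thesis
        using one[OF that(1)] card_le_Suc0_iff_eq[of "nbrs_above adj u v"] by auto
    qed
    have "card (walks adj (Suc l) x y) = card (walks adj (Suc l) x' y')"
      using w[of x y "Suc l"] w[of x' y' "Suc l"] y y' by simp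
    then show ?thesis
      using card_walks_Suc_nbrs[OF w, where x = x and y = y and l = l] y y'
        card_walks_Suc_nbrs[OF w, where x = x' and y = y' and l = l]
        single[OF y(2,1) zs(1)] single[OF y'(2,1) zs(2)]
        walk_regular_card_nbrs[OF wr val, of x y x' y'] by simp
  qed
  have "\<exists>v. \<forall>x y. d x y \<le> Suc s \<longrightarrow> card (walks adj l x y) = v (d x y)" for l
  proof -
    have "\<exists>n. \<forall>x y. d x y = Suc s \<longrightarrow> card (walks adj l x y) = n"
      using eq by metis
    then obtain n where n: "\<And>x y. d x y = Suc s \<Longrightarrow> card (walks adj l x y) = n" by blast
    have "\<forall>x y. d x y \<le> Suc s \<longrightarrow> card (walks adj l x y) = ((w l)(Suc s := n)) (d x y)"
      using n w by (auto simp: le_Suc_eq)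
    then show ?thesis by blast
  qed
  then show ?thesis
    using less by (simp add: walk_regular_def)
qed

text \<open>Walk-regularity and the bound on neighbours further out are carried together from
  \<open>t\<close> up to the diameter. The bound is an inequality since at the diameter there are no
  such neighbours.\<close>

lemma distance_regular_if_one_above:
  assumes wr: "walk_regular t adj" and val: "has_valency adj k"
    and one: "\<And>x y. d x y = t \<Longrightarrow> card (nbrs_above adj x y) \<le> 1"
  shows "distance_regular adj"
proof -
  have walk: "s \<le> diam adj \<Longrightarrow> walk_regular s adj \<and>
      (\<forall>x y. d x y = s \<longrightarrow> card (nbrs_above adj x y) \<le> 1)" if "t \<le> s" for s
    using that
  proof (induction s rule: dec_induct)
    case base
    show ?case using wr one by blast
  next
    case (step s)
    have "card (nbrs_above adj x y) \<le> 1" if xy: "d x y = Suc s" for x y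
    proof -
      \<comment> \<open>\<open>x'\<close> is the neighbour of \<open>x\<close> on a geodesic to
        \<open>y\<close>; it reduces distance \<open>s + 1\<close> to distance
        \<open>s\<close>.\<close>
      obtain x' where x': "adj x' x" "d y x' = s"
        using d_Suc_ex[of y x s] xy d_sym by metis
      then have "d x y = d x x' + d x' y"
        using d_adj[OF adj_sym] d_sym xy by simp
      then have "card (nbrs_above adj x y) \<le> card (nbrs_above adj x' y)"
        by (intro card_mono nbrs_above_antimono) auto
      also have "\<dots> \<le> 1"
        using step.IH step.prems x'(2) d_sym[of y x'] by (simp add: Suc_le_eq)
      finally show ?thesis .
    qed
    moreover have "walk_regular (Suc s) adj"
      using step by (intro walk_regular_Suc[OF _ val]) auto
    ultimately show ?case by blast
  qed
  have "t \<le> diam adj"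
    using wr by (simp add: walk_regular_def)
  then show ?thesis
    using walk[of "diam adj"] walk_regular_diam_imp_distance_regular val by blast
qed

end

section \<open>Vectors representing the vertices\<close>

text \<open>Otherwise each of the \<open>n + 1\<close> vectors up to \<open>v n\<close> would raise
  the dimension by one. The dependence has this triangular form because on a geodesic one vector is
  to be expressed by the earlier ones.\<close>

lemma ex_in_span_of_previous:
  fixes v :: "nat \<Rightarrow> 'a::euclidean_space"
  assumes "dim S \<le> n" and "range v \<subseteq> S"
  shows "\<exists>r\<le>n. v r \<in> span (v ` {..<r})"
proof (rule ccontr)
  assume neg: "\<not> ?thesis"
  have "dim (v ` {..<m}) = m" if "m \<le> Suc n" for m
    using that
  proof (induction m)
    case (Suc m)
    have "v m \<notin> span (v ` {..<m})"
      using neg Suc.prems by (meson Suc_le_mono)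
    moreover have "dim (v ` {..<m}) = m"
      using Suc by simp
    ultimately show ?case
      unfolding lessThan_Suc image_insert dim_insert by simp
  qed simp
  then have "dim (v ` {..<Suc n}) = Suc n"
    by blast
  moreover have "dim (v ` {..<Suc n}) \<le> dim S"
    using assms(2) by (intro dim_subset) auto
  ultimately show False
    using assms(1) by simp
qed

text \<open>\<open>u\<close> abstracts the rows of \<open>E\<close>. Inner products are prescribed
  only up to distance \<open>t\<close>, so their evaluation has to stay within that range.\<close>

locale graph_representation = connected_simple_graph adj
  for adj :: "'v::finite \<Rightarrow> 'v \<Rightarrow> bool" +
  fixes t k :: nat and \<theta> :: real and u :: "'v \<Rightarrow> 'a::euclidean_space" and \<alpha> :: "nat \<Rightarrow> real"
  assumes t_ge_2: "t \<ge> 2"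
    and valency: "has_valency adj k"
    and inner_u: "d x y \<le> t \<Longrightarrow> u x \<bullet> u y = \<alpha> (d x y)"
    and eigen: "\<theta> *\<^sub>R u x = (\<Sum>y | adj x y. u y)"
    and alpha_0: "\<alpha> 0 \<noteq> 0"
    and theta: "\<theta> \<noteq> real k" "\<theta> \<noteq> - real k"
begin

lemma u_self: "u x \<bullet> u x = \<alpha> 0"
  using inner_u[of x x] by simp

lemma u_nonzero: "u x \<noteq> 0"
  using u_self[of x] alpha_0 by auto

text \<open>All vectors have squared norm \<open>\<alpha> 0\<close>, so this is the equality case of
  the Cauchy-Schwarz inequality.\<close>

lemma u_eqI:
  assumes "u x \<bullet> u y = \<alpha> 0"
  shows "u x = u y"
proof -
  have "(u x - u y) \<bullet> (u x - u y) = 0"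
    using assms by (simp add: inner_diff_left inner_diff_right inner_commute u_self)
  then show ?thesis by simp
qed

lemma eigen_if_nbrs_equal:
  assumes "\<And>y. adj x y \<Longrightarrow> u y = v"
  shows "\<theta> *\<^sub>R u x = real k *\<^sub>R v"
proof -
  have "(\<Sum>y | adj x y. u y) = (\<Sum>y | adj x y. v)"
    using assms by (intro sum.cong) auto
  then show ?thesis
    using valency by (simp add: eigen has_valency_def sum_constant_scaleR)
qed

text \<open>One coincidence across an edge gives \<open>\<alpha> 1 = \<alpha> 0\<close>, hence a
  coincidence across every edge; the eigenvector equation then forces
  \<open>\<theta> = k\<close>.\<close>

lemma u_adj_neq:
  assumes "adj x y"
  shows "u x \<noteq> u y"
proof
  assume "u x = u y"
  then have "\<alpha> 1 = \<alpha> 0"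
    using inner_u[of x y] d_adj[OF assms] t_ge_2 u_self[of x] by simp
  then have "u z = u x" if "adj x z" for z
    using inner_u[of z x] d_adj[OF adj_sym[OF that]] t_ge_2 by (intro u_eqI) simp
  then have "\<theta> *\<^sub>R u x = real k *\<^sub>R u x"
    by (rule eigen_if_nbrs_equal)
  then show False
    using theta u_nonzero[of x] by simp
qed

text \<open>One coincidence spreads to all pairs at distance 2; then all neighbours of the first
  vertex of a long geodesic share one vector. Diameter 2 is a true exception: a regular complete
  multipartite graph with three or more parts, each of size at least 2, has a representation that is
  constant on the parts.\<close>

lemma u_d2_neq:
  assumes "2 < diam adj" and "d x y = 2"
  shows "u x \<noteq> u y"
proof
  assume "u x = u y"
  then have "\<alpha> 2 = \<alpha> 0"
    using inner_u[of x y] assms(2) t_ge_2 u_self[of x] by simp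
  then have d2: "u v = u w" if "d v w = 2" for v w
    using inner_u[of v w] that t_ge_2 by (intro u_eqI) simp
  obtain a b where "d a b = diam adj"
    using diam_attained by blast
  then obtain f where f: "\<And>p q. p \<le> q \<Longrightarrow> q \<le> diam adj \<Longrightarrow> d (f p) (f q) = q - p"
    using geodesic_ex by metis
  have d02: "d (f 0) (f 2) = 2" and d13: "d (f 1) (f 3) = 2" and d03: "d (f 0) (f 3) = 3"
    and d01: "d (f 0) (f 1) = 1" and d12: "d (f 1) (f 2) = 1"
    using assms(1) by (auto simp: f)
  have "u w = u (f 1)" if w: "adj (f 0) w" for w
  proof -
    have "d w (f 1) \<le> 2"
      using d_triangle[of w "f 1" "f 0"] d_adj[OF adj_sym[OF w]] d01 by simp
    then consider "w = f 1" | "d w (f 1) = 1" | "d w (f 1) = 2"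
      using d_eq_0_iff[of w "f 1"] by linarith
    then show ?thesis
    proof cases
      case 2
      \<comment> \<open>If \<open>w\<close> is adjacent to \<open>f 1\<close>, it is at distance 2
        from \<open>f 3\<close> or from \<open>f 2\<close>, and so shares its vector with its own
        neighbour \<open>f 1\<close> or \<open>f 0\<close>.\<close>
      have False
      proof (cases "d w (f 3) = 2")
        case True
        then have "u w = u (f 1)"
          using d2[of w "f 3"] d2[OF d13] by simp
        then show False
          using u_adj_neq 2 d_eq_1_iff by blast
      next
        case False
        have "d w (f 3) \<ge> 3"
          using False d_triangle[of "f 0" "f 3" w] d_adj[OF w] d03 by simp
        moreover have "d (f 2) (f 3) = 1"
          using assms(1) by (simp add: f)
        ultimately have "d w (f 2) = 2"
          using d_triangle[of w "f 3" "f 2"] d_triangle[of w "f 2" "f 1"] d12 2 by simp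
        then have "u w = u (f 0)"
          using d2[of w "f 2"] d2[OF d02] by simp
        then show False
          using u_adj_neq[OF w] by simp
      qed
      then show ?thesis ..
    qed (use d2 in auto)
  qed
  then have eq: "\<theta> *\<^sub>R u (f 0) = real k *\<^sub>R u (f 1)"
    by (rule eigen_if_nbrs_equal)
  have "\<theta>\<^sup>2 * \<alpha> 0 = (\<theta> *\<^sub>R u (f 0)) \<bullet> (\<theta> *\<^sub>R u (f 0))"
    by (simp add: u_self power2_eq_square)
  also have "\<dots> = (real k)\<^sup>2 * \<alpha> 0"
    unfolding eq by (simp add: u_self power2_eq_square)
  \<comment> \<open>Comparing norms leaves \<open>\<theta> = k\<close> or
    \<open>\<theta> = - k\<close>, and both are excluded.\<close>
  finally show False
    using alpha_0 theta power2_eq_iff[of \<theta> "real k"] by simp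
qed

text \<open>
  Godsil's argument: the projections of \<open>u z\<close> onto the span of a geodesic from \<open>x\<close> to \<open>y\<close>
  agree for all \<open>z\<close> above \<open>y\<close>; if one \<open>u z\<close> lies in this span, then all coincide with it.
\<close>

lemma card_nbrs_above_le_1:
  assumes wr: "walk_regular t adj" and dim: "dim (range u) \<le> t" and less: "t < diam adj"
    and xy: "d x y = t"
  shows "card (nbrs_above adj x y) \<le> 1"
proof -
  obtain a b where "d a b = diam adj"
    using diam_attained by blast
  then obtain f where f: "\<And>p q. p \<le> q \<Longrightarrow> q \<le> diam adj \<Longrightarrow> d (f p) (f q) = q - p"
    using geodesic_ex by metis
  \<comment> \<open>A geodesic of length \<open>t\<close> has \<open>t + 1\<close> vertices, one
    more than the dimension can accommodate independently.\<close>
  obtain r where r: "r \<le> t" "u (f r) \<in> span ((\<lambda>p. u (f p)) ` {..<r})"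
    using ex_in_span_of_previous[OF dim, of "\<lambda>p. u (f p)"] by auto
  \<comment> \<open>\<open>r = 0\<close> would put a nonzero vector into the span of the empty
    set.\<close>
  then obtain q where q: "r = Suc q"
    using u_nonzero by (cases r) auto
  have above: "u z = u (f r)" if z: "z \<in> nbrs_above adj (f 0) (f q)" for z
  proof -
    have z': "adj (f q) z" "d (f 0) z = r"
      using z r less q by (auto simp: nbrs_above_def f)
    \<comment> \<open>\<open>z\<close> and \<open>f r\<close> have the same distance from each
      earlier vertex \<open>f p\<close>. It is at most \<open>r \<le> t\<close>, so the inner
      products agree as well.\<close>
    have "d (f p) z = r - p" if "p < r" for p
      using d_triangle[of "f p" z "f q"] d_triangle[of "f 0" z "f p"] d_adj[OF z'(1)] z'(2)
        that r less q by (simp add: f)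
    then have "u (f p) \<bullet> u z = u (f p) \<bullet> u (f r)" if "p < r" for p
      using that r less inner_u[of "f p" z] inner_u[of "f p" "f r"] by (simp add: f)
    then have "orthogonal (u (f r) - u z) v" if "v \<in> (\<lambda>p. u (f p)) ` {..<r}" for v
      using that by (auto simp: orthogonal_def inner_diff_right inner_commute[of _ v])
    \<comment> \<open>Since \<open>u (f r)\<close> lies in the span, it is orthogonal to the
      difference, which gives \<open>u (f r) \<bullet> u z = \<alpha> 0\<close>.\<close>
    then have "orthogonal (u (f r) - u z) (u (f r))"
      using orthogonal_to_span r(2) by blast
    then show ?thesis
      by (intro u_eqI) (simp add: orthogonal_def inner_diff_left u_self)
  qed
  \<comment> \<open>Two neighbours of \<open>f q\<close> are at distance at most 2, where equal
    vectors force equal vertices.\<close>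
  have "z = z'" if "z \<in> nbrs_above adj (f 0) (f q)" "z' \<in> nbrs_above adj (f 0) (f q)" for z z'
  proof -
    have eq: "u z = u z'"
      using above that by simp
    have "d z z' \<le> 2"
      using that d_triangle[of z z' "f q"] d_adj[of "f q" z] d_adj[of "f q" z'] d_sym[of z "f q"]
      by (simp add: nbrs_above_def)
    moreover have "d z z' \<noteq> 1"
      using eq u_adj_neq d_eq_1_iff by blast
    moreover have "d z z' \<noteq> 2"
      using eq u_d2_neq less t_ge_2 by auto
    ultimately show ?thesis
      using d_eq_0_iff[of z z'] by linarith
  qed
  then have one: "card (nbrs_above adj (f 0) (f q)) \<le> 1"
    by (simp add: card_le_Suc0_iff_eq)
  obtain g where g: "g 0 = x" "g t = y" "\<And>p q. p \<le> q \<Longrightarrow> q \<le> t \<Longrightarrow> d (g p) (g q) = q - p"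
    using geodesic_ex[OF xy] by metis
  \<comment> \<open>\<open>x'\<close> is the vertex at distance \<open>q < t\<close> from
    \<open>y\<close> on the geodesic from \<open>x\<close>; monotonicity lifts the bound from
    distance \<open>q\<close> to distance \<open>t\<close>.\<close>
  define x' where "x' = g (t - q)"
  have x': "d x x' = t - q" "d x' y = q"
    using g(3)[of 0 "t - q"] g(3)[of "t - q" t] g(1,2) r q by (auto simp: x'_def)
  have "card (nbrs_above adj x y) \<le> card (nbrs_above adj x' y)"
    using x' xy r q by (intro card_mono nbrs_above_antimono) auto
  also have "\<dots> = card (nbrs_above adj (f 0) (f q))"
    using x' r q less by (intro walk_regular_card_nbrs(3)[OF wr valency]) (auto simp: f)
  finally show ?thesis
    using one by simp
qed

end

section \<open>From the idempotent to a representation\<close>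

text \<open>By symmetry the Gram matrix of the rows is \<open>E ** E\<close>.\<close>

lemma idempotent_row_inner:
  fixes E :: "real^'n^'n"
  assumes "transpose E = E" and "E ** E = E"
  shows "E $ x \<bullet> E $ y = E $ x $ y"
proof -
  have "E $ y $ z = E $ z $ y" for z
    using arg_cong[OF assms(1), of "\<lambda>M. M $ z $ y"] by (simp add: transpose_def)
  then have "E $ x \<bullet> E $ y = (E ** E) $ x $ y"
    by (simp add: inner_vec_def matrix_matrix_mult_def)
  then show ?thesis
    using assms(2) by simp
qed

theorem theorem6p3:
  fixes adj :: "'v::finite \<Rightarrow> 'v \<Rightarrow> bool"
    and t k :: nat and \<theta> :: real and E :: "real^'v^'v"
  assumes "simple_graph adj" and "connected_graph adj"
    and "t \<ge> 2" and "walk_regular t adj" and "has_valency adj k"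
    and "walk_regular_idempotent t adj \<theta> E" and "rank E \<le> t"
    and "\<theta> \<noteq> real k" and "\<theta> \<noteq> - real k"
  shows "distance_regular adj"
proof -
  interpret connected_simple_graph adj
    using assms(1,2) by unfold_locales
  show ?thesis
  proof (cases "t = diam adj")
    case True
    then show ?thesis
      using assms(4,5) walk_regular_diam_imp_distance_regular by simp
  next
    case False
    then have less: "t < diam adj"
      using assms(4) by (simp add: walk_regular_def)
    have E: "E \<noteq> 0" "transpose E = E" "E ** E = E" "adj_mat adj ** E = \<theta> *\<^sub>R E"
      using assms(6) by (simp_all add: walk_regular_idempotent_def)
    obtain \<alpha> where \<alpha>: "\<And>j. j \<le> t \<Longrightarrow>
        entrywise_prod (dist_mat adj j) E = \<alpha> j *\<^sub>R dist_mat adj j"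
      using assms(6) unfolding walk_regular_idempotent_def by blast
    \<comment> \<open>The entry at \<open>x\<close>, \<open>y\<close> of the equation for
      \<open>j = d x y\<close> says that \<open>E $ x $ y\<close> is
      \<open>\<alpha> (d x y)\<close>.\<close>
    have inner: "E $ x \<bullet> E $ y = \<alpha> (d x y)" if "d x y \<le> t" for x y
      using arg_cong[OF \<alpha>[OF that], of "\<lambda>M. M $ x $ y"] idempotent_row_inner[OF E(2,3)]
      by (simp add: entrywise_prod_def dist_mat_def)
    have eigen: "\<theta> *\<^sub>R E $ x = (\<Sum>y | adj x y. E $ y)" for x
    proof (rule vec_eq_iff[THEN iffD2, rule_format])
      fix z
      have "(\<theta> *\<^sub>R E $ x) $ z = (adj_mat adj ** E) $ x $ z"
        by (simp add: E(4))
      also have "\<dots> = (\<Sum>y\<in>UNIV. if adj x y then E $ y $ z else 0)"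
        by (auto simp: matrix_matrix_mult_def adj_mat_def intro!: sum.cong)
      also have "\<dots> = (\<Sum>y | adj x y. E $ y) $ z"
        by (simp add: sum.If_cases)
      finally show "(\<theta> *\<^sub>R E $ x) $ z = (\<Sum>y | adj x y. E $ y) $ z" .
    qed
    \<comment> \<open>\<open>\<alpha> 0\<close> is the squared norm of every row, so its vanishing
      would make \<open>E\<close> zero.\<close>
    have "\<alpha> 0 \<noteq> 0"
    proof
      assume "\<alpha> 0 = 0"
      then have "E $ x = 0" for x
        using inner[of x x] by simp
      then show False
        using E(1) by (simp add: vec_eq_iff)
    qed
    then interpret graph_representation adj t k \<theta> "\<lambda>x. E $ x" \<alpha>
      using assms(3,5,8,9) inner eigen by unfold_locales auto
    have "rows E = range (\<lambda>x. E $ x)"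
      by (auto simp: rows_def row_def vec_nth_inverse)
    then have "dim (range (\<lambda>x. E $ x)) \<le> t"
      using assms(7) by (simp add: row_rank_def)
    then show ?thesis
      using distance_regular_if_one_above[OF assms(4,5)] card_nbrs_above_le_1[OF assms(4) _ less]
      by blast
  qed
qed

end
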